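(* Let $E$ be a Banach space, $I=I^\infty=(-\infty,0]$, $H\subset\mathrm{Map}(I^\infty,E)$ a history space with $H\supset C^{0,1}_{\mathrm{loc}}(I^\infty,E)$ which is prolongable and regulated by prolongations, and $F\colon\mathbb{R}\times H\supset\mathrm{dom}(F)\to E$ a map. Let $F^{0,1}$ be the restriction of $F$ to $\mathrm{dom}(F^{0,1})=\mathrm{dom}(F)\cap\bigl(\mathbb{R}\times C^{0,1}_{\mathrm{loc}}(I^\infty,E)\bigr)$. If $F$ is almost locally Lipschitzian at $(\sigma_0,\psi_0)\in\mathrm{dom}(F^{0,1})$, then $F^{0,1}$ is locally Lipschitzian about $C^1$-prolongations at $(\sigma_0,\psi_0)$.
   Context: Basic notation. $\mathbb{R}_+=[0,\infty)$. $\mathrm{Map}(I,E)$ is the linear space of all maps $I\to E$; $\boldsymbol 0$ is the zero map. For an interval $J$, $J+I=\{t+\theta:t\in J,\theta\in I\}$. If $\gamma\colon J+I\to E$ and $t\in J$, then $I_t\gamma\in\mathrm{Map}(I,E)$ is $I_t\gamma(\theta)=\gamma(t+\theta)$. A history space is a linear subspace $H\subset\mathrm{Map}(I,E)$ with a topology for which the linear operations are continuous. $\mathrm{lip}(f)$ is the least Lipschitz constant of $f$ ($\infty$ if $f$ is not Lipschitz). $C^{0,1}_{\mathrm{loc}}(I,E)$ is the space of locally Lipschitz continuous maps $I\to E$. The map $F^{0,1}$ is regarded as a map $\mathbb{R}\times C^{0,1}_{\mathrm{loc}}(I,E)\supset\mathrm{dom}(F^{0,1})\to E$. Prolongations. For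 $(\sigma,\psi)\in\mathbb{R}\times\mathrm{Map}(I,E)$, a prolongation (resp. $C^1$-prolongation) of $(\sigma,\psi)$ is a map $\gamma\colon J+I\to E$, where $J$ is an interval with left end point $\sigma\in J$ ($J=\{\sigma\}$ allowed, counting as $C^1$), with $I_\sigma\gamma=\psi$ and $\gamma|_J$ continuous (resp. of class $C^1$). A prolongation of $\psi$ is one of $(0,\psi)$. For $v\in E$, $\psi^{\wedge v}\colon\mathbb{R}_++I\to E$ is $\psi^{\wedge v}(t)=\psi(t)$ for $t\in I$ and $\psi^{\wedge v}(t)=\psi(0)+tv$ for $t\ge0$. $\|g\|_{C^1[0,T]}=\sup_{[0,T]}\|g\|_E+\sup_{[0,T]}\|g'\|_E$. $\varGamma_{\sigma,\psi}(T,\delta)$ ($T\ge0$, $0\le\delta\le\infty$) is the set of prolongations $\gamma\colon[\sigma,\sigma+T]+I\to E$ of $(\sigma,\psi)$ with $\sup_{s\in[0,T]}\|\gamma(\sigma+s)-\psi(0)\|_E\le\delta$. $\varGamma^1_{\sigma,\psi}(T,\delta,v)$ ($T>0$) is the set of $C^1$-prolongations $\gamma\colon[\sigma,\sigma+T]+I\to E$ of $(\sigma,\psi)$ with $\|\gamma(\sigma+\cdot)-\psi^{\wedge v}(\cdot)\|_{C^1[0,T]}\le\delta$ and $\gamma'(\sigma)=v$ (right derivative); $\varGamma^1_{\sigma,\psi}(0,\delta,v)=\{\psi(\cdot-\sigma)\}$. Put $$\varLambda_{\sigma,\psi}(T,\delta)=\bigcup_{\tau\in[0,T]}\{(\sigma+\tau,I_{\sigma+\tau}\gamma):\gamma\in\varGamma_{\sigma,\psi}(\tau,\delta)\},$$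 $$\varLambda^1_{\sigma,\psi}(T,\delta,v)=\bigcup_{\tau\in[0,T]}\{(\sigma+\tau,I_{\sigma+\tau}\gamma):\gamma\in\varGamma^1_{\sigma,\psi}(\tau,\delta,v)\}.$$ $H$ is prolongable if for every $\psi\in H$ and every prolongation $\gamma\colon\mathbb{R}_++I\to E$ of $\psi$ one has $I_t\gamma\in H$ for all $t\ge0$ and $t\mapsto I_t\gamma\in H$ is continuous on $\mathbb{R}_+$. $H$ is regulated by prolongations if for every $T>0$ and every neighborhood $N$ of $\boldsymbol 0$ in $H$ there is $\delta>0$ with $\varLambda_{0,\boldsymbol 0}(T,\delta)\subset[0,T]\times N$. Lipschitz conditions. For a map $G$ with domain in $\mathbb{R}\times\mathrm{Map}(I,E)$, $L>0$ and $(t,\phi_1),(t,\phi_2)\in\mathrm{dom}(G)$ with $\mathrm{supp}(\phi_1-\phi_2)$ compact, $L$-(Lip) for $G$ is $\|G(t,\phi_1)-G(t,\phi_2)\|_E\le L\|\phi_1-\phi_2\|_\infty$. $F$ is almost locally Lipschitzian at $(\sigma_0,\psi_0)$ (case $I=I^\infty$) if for every sequence $(M_k)_{k\ge1}$ of positive numbers there are a neighborhood $W$ of $(\sigma_0,\psi_0)$ in $\mathbb{R}\times H$ and $L>0$ such that $L$-(Lip) for $F$ holds for all $(t,\phi_1),(t,\phi_2)\in W\cap\mathrm{dom}(F)$ such that $\mathrm{supp}(\phi_1-\phi_2)$ is compact and $\mathrm{lip}(\phi_1|_{[-k,0]}),\mathrm{lip}(\phi_2|_{[-k,0]})\le M_k$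 for all $k\ge1$. $F^{0,1}$ is locally Lipschitzian about $C^1$-prolongations at $(\sigma_0,\psi_0)\in\mathrm{dom}(F^{0,1})$ if there are $T,\delta,L>0$ such that $L$-(Lip) for $F^{0,1}$ holds for all $(t,\phi_1),(t,\phi_2)\in\varLambda^1_{\sigma_0,\psi_0}(T,\delta,v)\cap\mathrm{dom}(F^{0,1})$, where $v=F(\sigma_0,\psi_0)$. *)

theory Defs
  imports "HOL-Analysis.Analysis" "HOL-Library.Set_Algebras"
begin

text \<open>
  A map \<open>A \<rightarrow> E\<close> on a set of reals is represented by its extension by zero to the whole line.
  Thus \<open>Maps A\<close> is in bijection with the set of all maps \<open>A \<rightarrow> E\<close>, and the pointwise linear
  operations on \<open>real \<Rightarrow> E\<close> restrict to those of the linear space of maps.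
\<close>

definition Maps :: "real set \<Rightarrow> (real \<Rightarrow> 'e::real_normed_vector) set" where
  "Maps A = {f. \<forall>t. t \<notin> A \<longrightarrow> f t = 0}"

abbreviation Iinf :: "real set" where
  "Iinf \<equiv> {..0}"

definition segment :: "real \<Rightarrow> (real \<Rightarrow> 'e::real_normed_vector) \<Rightarrow> real \<Rightarrow> 'e" where
  "segment t \<gamma> = (\<lambda>\<theta>. if \<theta> \<in> Iinf then \<gamma> (t + \<theta>) else 0)"

text \<open>
  A history space is given by its topology; the underlying linear space is the carrier of the
  topology. No separation axiom is assumed.
\<close>

definition history_space :: "(real \<Rightarrow> 'e::real_normed_vector) topology \<Rightarrow> bool" where
  "history_space H \<longleftrightarrow>
     topspace H \<subseteq> Maps Iinf \<and>
     (\<lambda>_. 0) \<in> topspace H \<and>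
     (\<forall>\<phi>\<in>topspace H. \<forall>\<psi>\<in>topspace H. (\<lambda>\<theta>. \<phi> \<theta> + \<psi> \<theta>) \<in> topspace H) \<and>
     (\<forall>c. \<forall>\<phi>\<in>topspace H. (\<lambda>\<theta>. c *\<^sub>R \<phi> \<theta>) \<in> topspace H) \<and>
     continuous_map (prod_topology H H) H (\<lambda>(\<phi>, \<psi>). \<lambda>\<theta>. \<phi> \<theta> + \<psi> \<theta>) \<and>
     continuous_map (prod_topology euclideanreal H) H (\<lambda>(c, \<phi>). \<lambda>\<theta>. c *\<^sub>R \<phi> \<theta>)"

definition nhd_in :: "'a topology \<Rightarrow> 'a \<Rightarrow> 'a set \<Rightarrow> bool" where
  "nhd_in X x N \<longleftrightarrow> N \<subseteq> topspace X \<and> (\<exists>U. openin X U \<and> x \<in> U \<and> U \<subseteq> N)"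

definition lip :: "real set \<Rightarrow> (real \<Rightarrow> 'e::real_normed_vector) \<Rightarrow> ennreal" where
  "lip A f = (INF L\<in>{L. L-lipschitz_on A f}. ennreal L)"

definition C01loc :: "(real \<Rightarrow> 'e::real_normed_vector) set" where
  "C01loc = {f \<in> Maps Iinf. \<forall>t\<in>Iinf. \<exists>u>0. \<exists>L. L-lipschitz_on (cball t u \<inter> Iinf) f}"


subsection \<open>Prolongations\<close>

definition left_closed_interval :: "real \<Rightarrow> real set \<Rightarrow> bool" where
  "left_closed_interval \<sigma> J \<longleftrightarrow> is_interval J \<and> \<sigma> \<in> J \<and> J \<subseteq> {\<sigma>..}"

definition prolongation ::
    "real \<Rightarrow> (real \<Rightarrow> 'e::real_normed_vector) \<Rightarrow> real set \<Rightarrow> (real \<Rightarrow> 'e) \<Rightarrow> bool" where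
  "prolongation \<sigma> \<psi> J \<gamma> \<longleftrightarrow>
     left_closed_interval \<sigma> J \<and> \<gamma> \<in> Maps (J + Iinf) \<and> segment \<sigma> \<gamma> = \<psi> \<and> continuous_on J \<gamma>"

text \<open>
  Derivatives are taken relative to \<open>J\<close>, hence one-sided at the end points. For \<open>J = {\<sigma>}\<close> the
  filter \<open>at \<sigma> within J\<close> is trivial, so that the condition is void, as it should be.
\<close>

definition C1_on_interval :: "real set \<Rightarrow> (real \<Rightarrow> 'e::real_normed_vector) \<Rightarrow> bool" where
  "C1_on_interval J \<gamma> \<longleftrightarrow>
     (\<exists>D. (\<forall>t\<in>J. (\<gamma> has_vector_derivative D t) (at t within J)) \<and> continuous_on J D)"

definition C1_prolongation ::
    "real \<Rightarrow> (real \<Rightarrow> 'e::real_normed_vector) \<Rightarrow> real set \<Rightarrow> (real \<Rightarrow> 'e) \<Rightarrow> bool" where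
  "C1_prolongation \<sigma> \<psi> J \<gamma> \<longleftrightarrow>
     left_closed_interval \<sigma> J \<and> \<gamma> \<in> Maps (J + Iinf) \<and> segment \<sigma> \<gamma> = \<psi> \<and> C1_on_interval J \<gamma>"

definition linear_prolongation ::
    "(real \<Rightarrow> 'e::real_normed_vector) \<Rightarrow> 'e \<Rightarrow> real \<Rightarrow> 'e" where
  "linear_prolongation \<psi> v = (\<lambda>t. if t \<le> 0 then \<psi> t else \<psi> 0 + t *\<^sub>R v)"

text \<open>Meaningful for \<open>T > 0\<close> and \<open>g\<close> of class \<open>C\<^sup>1\<close> on \<open>[0, T]\<close>.\<close>

definition C1_norm :: "real \<Rightarrow> (real \<Rightarrow> 'e::real_normed_vector) \<Rightarrow> ennreal" where
  "C1_norm T g =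
     (SUP s\<in>{0..T}. ennreal (norm (g s))) +
     (SUP s\<in>{0..T}. ennreal (norm (vector_derivative g (at s within {0..T}))))"

definition Gam ::
    "real \<Rightarrow> (real \<Rightarrow> 'e::real_normed_vector) \<Rightarrow> real \<Rightarrow> ennreal \<Rightarrow> (real \<Rightarrow> 'e) set" where
  "Gam \<sigma> \<psi> T \<delta> =
     {\<gamma>. prolongation \<sigma> \<psi> {\<sigma>..\<sigma> + T} \<gamma> \<and>
          (SUP s\<in>{0..T}. ennreal (norm (\<gamma> (\<sigma> + s) - \<psi> 0))) \<le> \<delta>}"

definition Gam1 ::
    "real \<Rightarrow> (real \<Rightarrow> 'e::real_normed_vector) \<Rightarrow> real \<Rightarrow> ennreal \<Rightarrow> 'e \<Rightarrow> (real \<Rightarrow> 'e) set" where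
  "Gam1 \<sigma> \<psi> T \<delta> v =
     (if T = 0 then {\<lambda>t. \<psi> (t - \<sigma>)}
      else {\<gamma>. C1_prolongation \<sigma> \<psi> {\<sigma>..\<sigma> + T} \<gamma> \<and>
                C1_norm T (\<lambda>s. \<gamma> (\<sigma> + s) - linear_prolongation \<psi> v s) \<le> \<delta> \<and>
                (\<gamma> has_vector_derivative v) (at_right \<sigma>)})"

definition Lam ::
    "real \<Rightarrow> (real \<Rightarrow> 'e::real_normed_vector) \<Rightarrow> real \<Rightarrow> ennreal \<Rightarrow> (real \<times> (real \<Rightarrow> 'e)) set" where
  "Lam \<sigma> \<psi> T \<delta> =
     (\<Union>\<tau>\<in>{0..T}. {(\<sigma> + \<tau>, segment (\<sigma> + \<tau>) \<gamma>) |\<gamma>. \<gamma> \<in> Gam \<sigma> \<psi> \<tau> \<delta>})"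

definition Lam1 ::
    "real \<Rightarrow> (real \<Rightarrow> 'e::real_normed_vector) \<Rightarrow> real \<Rightarrow> ennreal \<Rightarrow> 'e \<Rightarrow> (real \<times> (real \<Rightarrow> 'e)) set"
  where
  "Lam1 \<sigma> \<psi> T \<delta> v =
     (\<Union>\<tau>\<in>{0..T}. {(\<sigma> + \<tau>, segment (\<sigma> + \<tau>) \<gamma>) |\<gamma>. \<gamma> \<in> Gam1 \<sigma> \<psi> \<tau> \<delta> v})"

definition prolongable :: "(real \<Rightarrow> 'e::real_normed_vector) topology \<Rightarrow> bool" where
  "prolongable H \<longleftrightarrow>
     (\<forall>\<psi>\<in>topspace H. \<forall>\<gamma>. prolongation 0 \<psi> {0..} \<gamma> \<longrightarrow>
        (\<forall>t\<ge>0. segment t \<gamma> \<in> topspace H) \<and>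
        continuous_map (top_of_set {0..}) H (\<lambda>t. segment t \<gamma>))"

definition regulated_by_prolongations ::
    "(real \<Rightarrow> 'e::real_normed_vector) topology \<Rightarrow> bool" where
  "regulated_by_prolongations H \<longleftrightarrow>
     (\<forall>T>0. \<forall>N. nhd_in H (\<lambda>_. 0) N \<longrightarrow> (\<exists>\<delta>>0. Lam 0 (\<lambda>_. 0) T \<delta> \<subseteq> {0..T} \<times> N))"


subsection \<open>Lipschitz conditions\<close>

text \<open>
  The supremum norm takes values in \<open>[0, \<infinity>]\<close>, since maps with compact support need not be bounded.
\<close>

definition sup_norm :: "(real \<Rightarrow> 'e::real_normed_vector) \<Rightarrow> ennreal" where
  "sup_norm \<phi> = (SUP \<theta>\<in>Iinf. ennreal (norm (\<phi> \<theta>)))"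

text \<open>As \<open>Iinf\<close> is closed in the line, the closure may be taken in the line.\<close>

definition supp :: "(real \<Rightarrow> 'e::real_normed_vector) \<Rightarrow> real set" where
  "supp \<phi> = closure {\<theta> \<in> Iinf. \<phi> \<theta> \<noteq> 0}"

text \<open>
  Maps with a domain in \<open>\<real> \<times> Maps Iinf\<close> are partial functions; \<open>Lip_cond\<close> is only used for pairs
  \<open>(t, \<phi>\<^sub>1)\<close>, \<open>(t, \<phi>\<^sub>2)\<close> in the domain such that \<open>\<phi>\<^sub>1 - \<phi>\<^sub>2\<close> has compact support.
\<close>

definition Lip_cond ::
    "real \<Rightarrow> (real \<times> (real \<Rightarrow> 'e::real_normed_vector) \<rightharpoonup> 'e) \<Rightarrow> real \<Rightarrow> (real \<Rightarrow> 'e) \<Rightarrow> (real \<Rightarrow> 'e) \<Rightarrow> bool"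
  where
  "Lip_cond L G t \<phi>1 \<phi>2 \<longleftrightarrow>
     ennreal (norm (the (G (t, \<phi>1)) - the (G (t, \<phi>2)))) \<le> ennreal L * sup_norm (\<lambda>\<theta>. \<phi>1 \<theta> - \<phi>2 \<theta>)"

definition almost_locally_Lipschitzian_at ::
    "(real \<Rightarrow> 'e::real_normed_vector) topology \<Rightarrow> (real \<times> (real \<Rightarrow> 'e) \<rightharpoonup> 'e) \<Rightarrow>
      real \<Rightarrow> (real \<Rightarrow> 'e) \<Rightarrow> bool" where
  "almost_locally_Lipschitzian_at H F \<sigma> \<psi> \<longleftrightarrow>
     (\<forall>M :: nat \<Rightarrow> real. (\<forall>k\<ge>1. M k > 0) \<longrightarrow>
       (\<exists>W L. nhd_in (prod_topology euclideanreal H) (\<sigma>, \<psi>) W \<and> L > 0 \<and>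
         (\<forall>t \<phi>1 \<phi>2.
            (t, \<phi>1) \<in> W \<inter> dom F \<and> (t, \<phi>2) \<in> W \<inter> dom F \<and>
            compact (supp (\<lambda>\<theta>. \<phi>1 \<theta> - \<phi>2 \<theta>)) \<and>
            (\<forall>k\<ge>1. lip {- real k..0} \<phi>1 \<le> ennreal (M k) \<and> lip {- real k..0} \<phi>2 \<le> ennreal (M k))
            \<longrightarrow> Lip_cond L F t \<phi>1 \<phi>2)))"

definition locally_Lipschitzian_about_C1_prolongations_at ::
    "(real \<times> (real \<Rightarrow> 'e::real_normed_vector) \<rightharpoonup> 'e) \<Rightarrow> real \<Rightarrow> (real \<Rightarrow> 'e) \<Rightarrow> bool" where
  "locally_Lipschitzian_about_C1_prolongations_at G \<sigma> \<psi> \<longleftrightarrow>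
     (\<exists>T \<delta> L :: real. T > 0 \<and> \<delta> > 0 \<and> L > 0 \<and>
       (\<forall>t \<phi>1 \<phi>2.
          (t, \<phi>1) \<in> Lam1 \<sigma> \<psi> T (ennreal \<delta>) (the (G (\<sigma>, \<psi>))) \<inter> dom G \<and>
          (t, \<phi>2) \<in> Lam1 \<sigma> \<psi> T (ennreal \<delta>) (the (G (\<sigma>, \<psi>))) \<inter> dom G \<and>
          compact (supp (\<lambda>\<theta>. \<phi>1 \<theta> - \<phi>2 \<theta>))
          \<longrightarrow> Lip_cond L G t \<phi>1 \<phi>2))"

definition restrict_C01 ::
    "(real \<times> (real \<Rightarrow> 'e::real_normed_vector) \<rightharpoonup> 'e) \<Rightarrow> (real \<times> (real \<Rightarrow> 'e) \<rightharpoonup> 'e)" where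
  "restrict_C01 F = F |` (UNIV \<times> C01loc)"

end

theory Submission
  imports Defs
begin

text \<open>
  Near the initial instant every member of \<open>\<Lambda>\<^sup>1\<close> is the given history \<open>\<psi>\<close>, translated by a
  time \<open>\<tau>\<close> and continued by a \<open>C\<^sup>1\<close> arc whose velocity stays within \<open>\<delta>\<close> of \<open>v\<close>. Two facts
  about such histories give the theorem.

  The first is a bound on the Lipschitz constants. On \<open>[-k, 0]\<close> the history is a piece of \<open>\<psi>\<close>,
  taken from \<open>[-k, 0]\<close> as well, followed by an arc with Lipschitz constant at most
  \<open>\<parallel>v\<parallel> + \<delta>\<close>. As \<open>\<psi>\<close> is Lipschitz on each \<open>[-k, 0]\<close> (\<open>C01loc_imp_lipschitz_on\<close>), one sequence
  \<open>M\<^sub>k\<close> serves all members of \<open>\<Lambda>\<^sup>1\<close> with \<open>T \<le> 1\<close> and \<open>\<delta> \<le> 1\<close> (\<open>Lam1_lipschitz_on\<close>). This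
  sequence depends on \<open>\<psi>\<close> and \<open>v\<close> only, so it can be handed to the almost local Lipschitz condition
  before \<open>T\<close> and \<open>\<delta>\<close> are chosen.

  The second is that the sets \<open>\<Lambda>\<^sup>1\<close> shrink to \<open>(\<sigma>, \<psi>)\<close> in \<open>\<real> \<times> H\<close> (\<open>Lam1_subset_nhd\<close>). A member
  of \<open>\<Lambda>\<^sup>1\<close> at time \<open>\<sigma> + \<tau>\<close> is the sum of \<open>I\<^sub>\<tau> \<psi>\<^sup>\<and>\<^sup>v\<close>, which tends to \<open>\<psi>\<close> because \<open>H\<close> is prolongable,
  and of the segment at \<open>\<tau>\<close> of a prolongation of \<open>0\<close> that is bounded by \<open>\<delta>\<close>, which is small
  in \<open>H\<close> because \<open>H\<close> is regulated by prolongations.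

  Hence \<open>T\<close> and \<open>\<delta>\<close> can be reduced until \<open>\<Lambda>\<^sup>1\<close> lies in the neighbourhood \<open>W\<close> that belongs to the
  sequence \<open>M\<^sub>k\<close>, and the constant \<open>L\<close> found for \<open>W\<close> is the one required.
\<close>

section \<open>Local Lipschitz continuity on the half-line\<close>

lemma lip_le:
  assumes "M-lipschitz_on A f"
  shows "lip A f \<le> ennreal M"
  unfolding lip_def using assms by (intro INF_lower) auto

text \<open>
  A locally Lipschitz map is Lipschitz on compact sets, a fact about uniform families
  that is applied here to the family with the single member \<open>f\<close>.
\<close>

lemma C01loc_imp_lipschitz_on:
  assumes f: "f \<in> C01loc" and "compact A" "A \<subseteq> Iinf"
  obtains L where "L-lipschitz_on A f"
proof -
  have "local_lipschitz {0::real} Iinf (\<lambda>_. f)"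
  proof (rule local_lipschitzI)
    fix t x :: real
    assume "x \<in> Iinf"
    with f obtain u L where "u > 0" "L-lipschitz_on (cball x u \<inter> Iinf) f"
      unfolding C01loc_def by blast
    then show "\<exists>u>0. \<exists>L. \<forall>t\<in>cball t u \<inter> {0}. L-lipschitz_on (cball x u \<inter> Iinf) f"
      by blast
  qed
  then have "local_lipschitz {0::real} A (\<lambda>_. f)"
    by (rule local_lipschitz_subset) (use assms in auto)
  then show ?thesis
  proof (rule local_lipschitz_compact_implies_lipschitz)
    show thesis if "\<And>t. t \<in> {0::real} \<Longrightarrow> L-lipschitz_on A f" for L
      using that[of 0] by (intro \<open>\<And>L. L-lipschitz_on A f \<Longrightarrow> thesis\<close>) simp
  qed (use assms in auto)
qed

section \<open>\<open>C\<^sup>1\<close>-prolongations close to the linear one\<close>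

lemma Icc_plus_Iinf:
  assumes "a \<le> b"
  shows "{a..b} + Iinf = {..b::real}"
proof
  show "{a..b} + Iinf \<subseteq> {..b}"
    by (auto elim!: set_plus_elim)
  show "{..b} \<subseteq> {a..b} + Iinf"
  proof
    fix x assume "x \<in> {..b}"
    with assms have "b + (x - b) \<in> {a..b} + Iinf"
      by (intro set_plus_intro) auto
    then show "x \<in> {a..b} + Iinf" by simp
  qed
qed

lemma Ici_plus_Iinf: "{0..} + Iinf = (UNIV :: real set)"
proof -
  have "x \<in> {0..} + Iinf" for x :: real
  proof -
    have "max x 0 + min x 0 \<in> {0..} + Iinf"
      by (intro set_plus_intro) auto
    then show ?thesis by (simp add: max_def min_def split: if_splits)
  qed
  then show ?thesis by auto
qed

lemma segment_eqD:
  assumes "segment \<sigma> \<gamma> = \<psi>" "s \<le> 0"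
  shows "\<gamma> (\<sigma> + s) = \<psi> s"
  using fun_cong[OF assms(1), of s] assms(2) by (simp add: segment_def)

lemma has_vector_derivative_translate_Icc:
  fixes f :: "real \<Rightarrow> 'e::real_normed_vector"
  assumes "(f has_vector_derivative D) (at (\<sigma> + s) within {\<sigma>..\<sigma> + T})"
  shows "((\<lambda>s. f (\<sigma> + s)) has_vector_derivative D) (at s within {0..T})"
proof -
  have img: "(\<lambda>s. \<sigma> + s) ` {0..T} = {\<sigma>..\<sigma> + T}"
    by simp
  have "((\<lambda>s. \<sigma> + s) has_vector_derivative 1) (at s within {0..T})"
    by (auto intro!: derivative_eq_intros)
  from vector_diff_chain_within[OF this] assms show ?thesis
    unfolding img by (simp add: o_def)
qed

text \<open>
  The \<open>C\<^sup>1\<close> bound in \<open>Gam1\<close> contains two estimates on the deviation from the linear prolongation: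
  its size, used for closeness in \<open>H\<close>, and its derivative, which by the
  mean value inequality gives a Lipschitz constant.
\<close>

lemma Gam1_deviation:
  assumes \<gamma>: "\<gamma> \<in> Gam1 \<sigma> \<psi> T (ennreal \<delta>) v" and T: "T > 0" and \<delta>: "\<delta> \<ge> 0"
  defines "g \<equiv> \<lambda>s. \<gamma> (\<sigma> + s) - linear_prolongation \<psi> v s"
  shows "\<And>s. s \<in> {0..T} \<Longrightarrow> norm (g s) \<le> \<delta>"
    and "\<delta>-lipschitz_on {0..T} g"
proof -
  have "C1_prolongation \<sigma> \<psi> {\<sigma>..\<sigma> + T} \<gamma>" and C1: "C1_norm T g \<le> ennreal \<delta>"
    using \<gamma> T by (auto simp: Gam1_def g_def)
  then obtain D where D: "\<And>t. t \<in> {\<sigma>..\<sigma> + T} \<Longrightarrow>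
      (\<gamma> has_vector_derivative D t) (at t within {\<sigma>..\<sigma> + T})"
    unfolding C1_prolongation_def C1_on_interval_def by blast
  have deriv: "(g has_vector_derivative D (\<sigma> + s) - v) (at s within {0..T})"
    if s: "s \<in> {0..T}" for s
  proof (rule has_vector_derivative_transform[OF s])
    show "((\<lambda>s. \<gamma> (\<sigma> + s) - (\<psi> 0 + s *\<^sub>R v)) has_vector_derivative D (\<sigma> + s) - v)
        (at s within {0..T})"
      using s by (auto intro!: derivative_eq_intros has_vector_derivative_translate_Icc D)
  qed (auto simp: g_def linear_prolongation_def)
  have vd: "vector_derivative g (at s within {0..T}) = D (\<sigma> + s) - v" if "s \<in> {0..T}" for s
    using vector_derivative_within_cbox[of 0 T s g] deriv[OF that] T that by simp
  show "norm (g s) \<le> \<delta>" if s: "s \<in> {0..T}" for s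
  proof -
    have "ennreal (norm (g s)) \<le> (SUP s\<in>{0..T}. ennreal (norm (g s)))"
      using s by (intro SUP_upper)
    also have "\<dots> \<le> C1_norm T g"
      unfolding C1_norm_def by simp
    finally show ?thesis
      using C1 \<delta> by (metis ennreal_le_iff order_trans)
  qed
  have bound: "norm (D (\<sigma> + s) - v) \<le> \<delta>" if s: "s \<in> {0..T}" for s
  proof -
    have "ennreal (norm (D (\<sigma> + s) - v))
        \<le> (SUP s\<in>{0..T}. ennreal (norm (vector_derivative g (at s within {0..T}))))"
      by (rule SUP_upper2[OF s]) (simp only: vd[OF s])
    also have "\<dots> \<le> C1_norm T g"
      unfolding C1_norm_def by simp
    finally show ?thesis
      using C1 \<delta> by (metis ennreal_le_iff order_trans)
  qed
  show "\<delta>-lipschitz_on {0..T} g"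
  proof (rule bounded_derivative_imp_lipschitz)
    show "(g has_derivative (\<lambda>h. h *\<^sub>R (D (\<sigma> + s) - v))) (at s within {0..T})"
      if "s \<in> {0..T}" for s
      using deriv[OF that] by (simp add: has_vector_derivative_def)
    show "onorm (\<lambda>h. h *\<^sub>R (D (\<sigma> + s) - v)) \<le> \<delta>" if "s \<in> {0..T}" for s
    proof (rule onorm_le)
      show "norm (h *\<^sub>R (D (\<sigma> + s) - v)) \<le> \<delta> * norm h" for h
        using mult_right_mono[OF bound[OF that] norm_ge_zero[of h]]
        by (simp only: norm_scaleR real_norm_def mult.commute)
    qed
  qed (use \<delta> in auto)
qed

text \<open>
  For \<open>\<tau> = 0\<close> the only history is \<open>\<psi>\<close> itself, because \<open>Gam1\<close> consists of the translate of \<open>\<psi>\<close> then.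
\<close>

lemma Lam1_cases:
  assumes "(t, \<phi>) \<in> Lam1 \<sigma> \<psi> T \<delta> v" and \<psi>: "\<psi> \<in> Maps Iinf"
  obtains (initial) "t = \<sigma>" "\<phi> = \<psi>"
  | (later) \<tau> \<gamma> where "0 < \<tau>" "\<tau> \<le> T" "t = \<sigma> + \<tau>" "\<phi> = segment (\<sigma> + \<tau>) \<gamma>"
      "\<gamma> \<in> Gam1 \<sigma> \<psi> \<tau> \<delta> v"
proof -
  from assms(1) obtain \<tau> \<gamma> where *: "\<tau> \<in> {0..T}" "t = \<sigma> + \<tau>" "\<phi> = segment (\<sigma> + \<tau>) \<gamma>"
      "\<gamma> \<in> Gam1 \<sigma> \<psi> \<tau> \<delta> v"
    unfolding Lam1_def by auto
  show thesis
  proof (cases "\<tau> = 0")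
    case True
    with * have "\<phi> = \<psi>"
      using \<psi> by (auto simp: Gam1_def segment_def Maps_def fun_eq_iff)
    with * True show ?thesis by (intro initial) auto
  next
    case False
    with * show ?thesis by (intro later) auto
  qed
qed

lemma Lam1_mono:
  assumes "T \<le> T'" "\<delta> \<le> \<delta>'"
  shows "Lam1 \<sigma> \<psi> T \<delta> v \<subseteq> Lam1 \<sigma> \<psi> T' \<delta>' v"
proof -
  have "Gam1 \<sigma> \<psi> \<tau> \<delta> v \<subseteq> Gam1 \<sigma> \<psi> \<tau> \<delta>' v" for \<tau>
    using assms(2) by (auto simp: Gam1_def)
  then show ?thesis
    using assms(1) unfolding Lam1_def by fastforce
qed

section \<open>A uniform Lipschitz bound\<close>

text \<open>
  The requirement \<open>T \<le> k\<close> keeps the corner at \<open>0\<close> of the prolonged map inside the window \<open>[\<tau> - k, \<tau>]\<close>;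
  the part of the window to the left of \<open>0\<close> lies in \<open>[-k, 0]\<close>, where \<open>\<psi>\<close> has constant \<open>K\<close>.
\<close>

lemma Lam1_lipschitz_on:
  assumes mem: "(t, \<phi>) \<in> Lam1 \<sigma> \<psi> T (ennreal \<delta>) v" and \<psi>: "\<psi> \<in> Maps Iinf"
    and K: "K-lipschitz_on {- k..0} \<psi>" "norm v + \<delta> \<le> K"
    and "\<delta> \<ge> 0" "T \<le> k"
  shows "K-lipschitz_on {- k..0} \<phi>"
  using mem \<psi>
proof (cases rule: Lam1_cases)
  case initial
  with K show ?thesis by simp
next
  case (later \<tau> \<gamma>)
  define g where "g = (\<lambda>s. \<gamma> (\<sigma> + s) - linear_prolongation \<psi> v s)"
  have past: "\<gamma> (\<sigma> + s) = \<psi> s" if "s \<le> 0" for s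
    using later that by (auto simp: Gam1_def C1_prolongation_def intro: segment_eqD)
  have "\<delta>-lipschitz_on {0..\<tau>} g"
    unfolding g_def using later \<open>\<delta> \<ge> 0\<close> by (intro Gam1_deviation(2)) auto
  moreover have "(norm v)-lipschitz_on {0..\<tau>} (\<lambda>s. \<psi> 0 + s *\<^sub>R v)"
    by (auto intro!: lipschitz_onI simp: dist_norm mult.commute simp flip: scaleR_left_diff_distrib)
  ultimately have "(norm v + \<delta>)-lipschitz_on {0..\<tau>} (\<lambda>s. (\<psi> 0 + s *\<^sub>R v) + g s)"
    by (intro lipschitz_on_add)
  then have "K-lipschitz_on {0..\<tau>} (\<lambda>s. (\<psi> 0 + s *\<^sub>R v) + g s)"
    using K by (auto intro: lipschitz_on_mono)
  then have right: "K-lipschitz_on {0..\<tau>} (\<lambda>s. \<gamma> (\<sigma> + s))"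
    by (rule lipschitz_on_transform) (auto simp: g_def linear_prolongation_def)
  have left: "K-lipschitz_on {- k..0} (\<lambda>s. \<gamma> (\<sigma> + s))"
    using K(1) by (rule lipschitz_on_transform) (auto simp: past)
  have "K-lipschitz_on {- k..\<tau>} (\<lambda>s. \<gamma> (\<sigma> + s))"
    using lipschitz_on_concat[OF left right] by simp
  then have "K-lipschitz_on {- k..0} (\<lambda>\<theta>. \<gamma> (\<sigma> + (\<tau> + \<theta>)))"
    unfolding lipschitz_on_def using later by (auto simp: dist_norm dest!: bspec[of _ _ "\<tau> + _"])
  then show ?thesis
    by (rule lipschitz_on_transform) (use later in \<open>auto simp: segment_def add.assoc\<close>)
qed

section \<open>Closeness in the history space\<close>

lemma prolongation_linear_prolongation:
  assumes "\<psi> \<in> Maps Iinf"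
  shows "prolongation 0 \<psi> {0..} (linear_prolongation \<psi> v)"
proof -
  have "continuous_on {0..} (\<lambda>t. \<psi> 0 + t *\<^sub>R v)"
    by (intro continuous_intros)
  then have "continuous_on {0..} (linear_prolongation \<psi> v)"
    by (rule continuous_on_eq) (auto simp: linear_prolongation_def)
  moreover have "segment 0 (linear_prolongation \<psi> v) = \<psi>"
    using assms by (auto simp: segment_def linear_prolongation_def Maps_def fun_eq_iff)
  ultimately show ?thesis
    by (simp add: prolongation_def left_closed_interval_def Ici_plus_Iinf Maps_def is_interval_ci)
qed

text \<open>
  Elements of \<open>Maps\<close> vanish off their domain, so the deviation has to be cut off
  after \<open>\<tau>\<close>; this does not affect its segment at \<open>\<tau>\<close>.
\<close>

lemma Gam1_deviation_in_Gam:
  assumes \<gamma>: "\<gamma> \<in> Gam1 \<sigma> \<psi> \<tau> (ennreal \<delta>) v" and \<tau>: "\<tau> > 0" and \<delta>: "\<delta> \<ge> 0"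
  shows "(\<lambda>s. if s \<le> \<tau> then \<gamma> (\<sigma> + s) - linear_prolongation \<psi> v s else 0)
    \<in> Gam 0 (\<lambda>_. 0) \<tau> (ennreal \<delta>)" (is "?g \<in> _")
proof -
  note dev = Gam1_deviation[OF assms]
  have past: "\<gamma> (\<sigma> + s) = \<psi> s" if "s \<le> 0" for s
    using \<gamma> \<tau> that by (auto simp: Gam1_def C1_prolongation_def intro: segment_eqD)
  have "continuous_on {0..\<tau>} ?g"
    using lipschitz_on_continuous_on[OF dev(2)] by (rule continuous_on_eq) auto
  moreover have "segment 0 ?g = (\<lambda>_. 0)"
    using \<tau> by (auto simp: segment_def past linear_prolongation_def fun_eq_iff)
  moreover have "?g \<in> Maps ({0..\<tau>} + Iinf)"
    using \<tau> by (subst Icc_plus_Iinf) (auto simp: Maps_def)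
  ultimately have "prolongation 0 (\<lambda>_. 0) {0..0 + \<tau>} ?g"
    using \<tau> by (simp add: prolongation_def left_closed_interval_def is_interval_cc)
  moreover have "(SUP s\<in>{0..\<tau>}. ennreal (norm (?g (0 + s) - 0))) \<le> ennreal \<delta>"
    using dev(1) by (intro SUP_least) (auto intro!: ennreal_leI)
  ultimately show ?thesis
    unfolding Gam_def by blast
qed

text \<open>
  The choices are made in this order. Continuity of addition at \<open>(\<psi>, 0)\<close> splits the given
  neighbourhood \<open>U\<close> of \<open>\<psi>\<close> into \<open>A + B\<close>; continuity of \<open>\<tau> \<mapsto> I\<^sub>\<tau> \<psi>\<^sup>\<and>\<^sup>v\<close> yields a time \<open>T\<close> up to which the linear
  prolongation stays in \<open>A\<close>; only then is \<open>\<delta>\<close> taken from regulation by prolongations, for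
  this \<open>T\<close> and for the neighbourhood \<open>B\<close> of \<open>0\<close>.
\<close>

lemma Lam1_subset_nhd:
  assumes H: "history_space H" "prolongable H" "regulated_by_prolongations H"
    and \<psi>: "\<psi> \<in> topspace H"
    and W: "nhd_in (prod_topology euclideanreal H) (\<sigma>, \<psi>) W"
  obtains T \<delta> :: real where "T > 0" "\<delta> > 0" "Lam1 \<sigma> \<psi> T (ennreal \<delta>) v \<subseteq> W"
proof -
  define lin where "lin = linear_prolongation \<psi> v"
  from H(1) \<psi> have \<psi>M: "\<psi> \<in> Maps Iinf"
    and zero: "(\<lambda>_. 0) \<in> topspace H"
    and add: "continuous_map (prod_topology H H) H (\<lambda>(\<phi>, \<psi>). \<lambda>\<theta>. \<phi> \<theta> + \<psi> \<theta>)"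
    unfolding history_space_def by blast+
  from W obtain S U where S: "open S" "\<sigma> \<in> S" and U: "openin H U" "\<psi> \<in> U" and SU: "S \<times> U \<subseteq> W"
    unfolding nhd_in_def openin_prod_topology_alt by (metis open_openin subset_trans)
  define P where "P = {z \<in> topspace (prod_topology H H). (case z of (\<phi>, \<psi>) \<Rightarrow> \<lambda>\<theta>. \<phi> \<theta> + \<psi> \<theta>) \<in> U}"
  have "openin (prod_topology H H) P"
    unfolding P_def using add U(1) by (rule openin_continuous_map_preimage)
  moreover have "(\<psi>, \<lambda>_. 0) \<in> P"
    using \<psi> zero U(2) by (simp add: P_def)
  ultimately obtain A B where A: "openin H A" "\<psi> \<in> A" and B: "openin H B" "(\<lambda>_. 0) \<in> B"
    and AB: "A \<times> B \<subseteq> P"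
    unfolding openin_prod_topology_alt by blast
  have sum_in_U: "(\<lambda>\<theta>. \<phi> \<theta> + \<eta> \<theta>) \<in> U" if "\<phi> \<in> A" "\<eta> \<in> B" for \<phi> \<eta>
    using that AB by (auto simp: P_def)
  have seg0: "segment 0 lin = \<psi>"
    using prolongation_linear_prolongation[OF \<psi>M] by (simp add: prolongation_def lin_def)
  have "continuous_map (top_of_set {0..}) H (\<lambda>t. segment t lin)"
    using H(2) \<psi> prolongation_linear_prolongation[OF \<psi>M] unfolding prolongable_def lin_def by blast
  from openin_continuous_map_preimage[OF this A(1)]
  have "openin (top_of_set {0..}) {t \<in> {0..}. segment t lin \<in> A}" by simp
  then obtain r where "r > 0" and r: "\<And>t. t \<ge> 0 \<Longrightarrow> t < r \<Longrightarrow> segment t lin \<in> A"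
    unfolding openin_euclidean_subtopology_iff using seg0 A(2)
    by (auto simp: dist_real_def)
  from S obtain e where "e > 0" and e: "\<And>t. \<bar>t - \<sigma>\<bar> < e \<Longrightarrow> t \<in> S"
    unfolding open_dist by (auto simp: dist_real_def)
  define T where "T = min r e / 2"
  have T: "T > 0" "T < r" "T < e"
    using \<open>r > 0\<close> \<open>e > 0\<close> by (auto simp: T_def)
  have "nhd_in H (\<lambda>_. 0) B"
    using B by (auto simp: nhd_in_def dest: openin_subset)
  then obtain d where "d > 0" and d: "Lam 0 (\<lambda>_. 0) T d \<subseteq> {0..T} \<times> B"
    using H(3) T(1) unfolding regulated_by_prolongations_def by blast
  \<comment> \<open>Regulation only provides an extended bound; a positive real one below it is enough.\<close>
  obtain \<delta> where \<delta>: "\<delta> > 0" "ennreal \<delta> \<le> d"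
  proof (cases d)
    case (real x)
    with \<open>d > 0\<close> show ?thesis by (intro that[of x]) auto
  qed (use that[of 1] in auto)
  have "(t, \<phi>) \<in> W" if mem: "(t, \<phi>) \<in> Lam1 \<sigma> \<psi> T (ennreal \<delta>) v" for t \<phi>
    using mem \<psi>M
  proof (cases rule: Lam1_cases)
    case initial
    with S U SU show ?thesis by auto
  next
    case (later \<tau> \<gamma>)
    define g where "g = (\<lambda>s. if s \<le> \<tau> then \<gamma> (\<sigma> + s) - lin s else 0)"
    have "g \<in> Gam 0 (\<lambda>_. 0) \<tau> (ennreal \<delta>)"
      unfolding g_def lin_def using later \<delta> by (intro Gam1_deviation_in_Gam) auto
    then have "g \<in> Gam 0 (\<lambda>_. 0) \<tau> d"
      using \<delta>(2) by (auto simp: Gam_def)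
    then have "(0 + \<tau>, segment (0 + \<tau>) g) \<in> Lam 0 (\<lambda>_. 0) T d"
      unfolding Lam_def using later by fastforce
    then have "segment \<tau> g \<in> B"
      using d by auto
    moreover have "segment \<tau> lin \<in> A"
      using later T by (intro r) auto
    moreover have "\<phi> = (\<lambda>\<theta>. segment \<tau> lin \<theta> + segment \<tau> g \<theta>)"
      using later by (auto simp: segment_def g_def add.assoc)
    ultimately have "\<phi> \<in> U"
      using sum_in_U by simp
    moreover have "t \<in> S"
      using later T by (intro e) auto
    ultimately show ?thesis
      using SU by auto
  qed
  then show ?thesis
    using T(1) \<delta>(1) by (intro that[of T \<delta>]) auto
qed

section \<open>From almost local Lipschitz continuity to prolongations\<close>

theorem theorem4p8:
  fixes H :: "(real \<Rightarrow> 'e::banach) topology"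
    and F :: "real \<times> (real \<Rightarrow> 'e) \<rightharpoonup> 'e"
    and \<sigma>0 :: real and \<psi>0 :: "real \<Rightarrow> 'e"
  assumes "history_space H"
    and "C01loc \<subseteq> topspace H"
    and "prolongable H"
    and "regulated_by_prolongations H"
    and "dom F \<subseteq> UNIV \<times> topspace H"
    and "(\<sigma>0, \<psi>0) \<in> dom (restrict_C01 F)"
    and "almost_locally_Lipschitzian_at H F \<sigma>0 \<psi>0"
  shows "locally_Lipschitzian_about_C1_prolongations_at (restrict_C01 F) \<sigma>0 \<psi>0"
proof -
  define v where "v = the (restrict_C01 F (\<sigma>0, \<psi>0))"
  have \<psi>0: "\<psi>0 \<in> C01loc"
    using assms(6) by (auto simp: restrict_C01_def)
  then have \<psi>0H: "\<psi>0 \<in> topspace H" and \<psi>0M: "\<psi>0 \<in> Maps Iinf"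
    using assms(2) by (auto simp: C01loc_def)
  have "\<exists>L. L-lipschitz_on {- real k..0} \<psi>0" for k
    by (rule C01loc_imp_lipschitz_on[OF \<psi>0, of "{- real k..0}"]) auto
  then obtain K where K: "\<And>k. (K k)-lipschitz_on {- real k..0} \<psi>0"
    by metis
  \<comment> \<open>The summand \<open>1\<close> is the largest deviation \<open>\<delta>\<close> to be allowed, and it makes \<open>M k\<close> positive.\<close>
  define M where "M k = max (K k) (norm v + 1)" for k
  have M: "M k > 0" "(M k)-lipschitz_on {- real k..0} \<psi>0" for k
  proof -
    have "0 < norm v + 1"
      by (intro add_nonneg_pos) auto
    then show "M k > 0"
      unfolding M_def by linarith
    show "(M k)-lipschitz_on {- real k..0} \<psi>0"
      using K[of k] by (rule lipschitz_on_mono) (auto simp: M_def)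
  qed
  obtain W L where W: "nhd_in (prod_topology euclideanreal H) (\<sigma>0, \<psi>0) W" and L: "L > 0"
    and Lip: "\<forall>t \<phi>1 \<phi>2. (t, \<phi>1) \<in> W \<inter> dom F \<and> (t, \<phi>2) \<in> W \<inter> dom F \<and>
        compact (supp (\<lambda>\<theta>. \<phi>1 \<theta> - \<phi>2 \<theta>)) \<and>
        (\<forall>k\<ge>1. lip {- real k..0} \<phi>1 \<le> ennreal (M k) \<and> lip {- real k..0} \<phi>2 \<le> ennreal (M k))
        \<longrightarrow> Lip_cond L F t \<phi>1 \<phi>2"
    using assms(7)[unfolded almost_locally_Lipschitzian_at_def, rule_format, of M] M(1) by blast
  obtain T' \<delta>' :: real where pos: "T' > 0" "\<delta>' > 0" and sub: "Lam1 \<sigma>0 \<psi>0 T' (ennreal \<delta>') v \<subseteq> W"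
    using Lam1_subset_nhd[OF assms(1,3,4) \<psi>0H W] .
  define T \<delta> where "T = min T' 1" and "\<delta> = min \<delta>' 1"
  have T\<delta>: "T > 0" "T \<le> 1" "\<delta> > 0" "\<delta> \<le> 1"
    using pos by (auto simp: T_def \<delta>_def)
  have in_W: "Lam1 \<sigma>0 \<psi>0 T (ennreal \<delta>) v \<subseteq> W"
    by (rule subset_trans[OF Lam1_mono sub]) (auto simp: T_def \<delta>_def intro!: ennreal_leI)
  have lip: "lip {- real k..0} \<phi> \<le> ennreal (M k)"
    if "(t, \<phi>) \<in> Lam1 \<sigma>0 \<psi>0 T (ennreal \<delta>) v" "k \<ge> 1" for t \<phi> k
    using that T\<delta> M(2)[of k]
    by (intro lip_le Lam1_lipschitz_on[OF that(1) \<psi>0M]) (auto simp: M_def)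
  have "Lip_cond L (restrict_C01 F) t \<phi>1 \<phi>2"
    if 1: "(t, \<phi>1) \<in> Lam1 \<sigma>0 \<psi>0 T (ennreal \<delta>) v \<inter> dom (restrict_C01 F)"
      and 2: "(t, \<phi>2) \<in> Lam1 \<sigma>0 \<psi>0 T (ennreal \<delta>) v \<inter> dom (restrict_C01 F)"
      and "compact (supp (\<lambda>\<theta>. \<phi>1 \<theta> - \<phi>2 \<theta>))" for t \<phi>1 \<phi>2
  proof -
    have "Lip_cond L F t \<phi>1 \<phi>2"
      using that in_W
      by (intro Lip[rule_format] conjI allI impI lip) (auto simp: restrict_C01_def)
    moreover have "restrict_C01 F (t, \<phi>1) = F (t, \<phi>1)" "restrict_C01 F (t, \<phi>2) = F (t, \<phi>2)"
      using 1 2 by (auto simp: restrict_C01_def)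
    ultimately show ?thesis
      by (simp add: Lip_cond_def)
  qed
  then show ?thesis
    unfolding locally_Lipschitzian_about_C1_prolongations_at_def v_def[symmetric]
    using T\<delta> L by blast
qed

end
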